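(* Let $n\ge 4$, let $a^n=(a_1,\dots,a_n)$ be a vector of positive link lengths, and let $L^{n-3}=(L_2,\dots,L_{n-2})\in\mathcal{DS}(a^n)$. Put $L_0:=0$, $L_1:=a_1$, $L_{n-1}:=a_n$. Then the preimage of $L^{n-3}$ under the map that assigns to each circular configuration $\beta^{n-1}\in\mathcal{CC}^{\mathrm{onf}}(a^n)$ its diagonal vector $(L_2(\beta^2),\dots,L_{n-2}(\beta^{n-2}))$ consists exactly of those $\beta^{n-1}=(\beta_1,\dots,\beta_{n-1})\in(S^1)^{n-1}$ which are obtained recursively for $k=1,\dots,n-1$ by the following choices: (a) if $L_{k-1}=0$ (in particular if $k=1$), then $\beta_k$ is an arbitrary angle; (b) if $L_{k-1}>0$, then for some $\varepsilon_k\in\{0,1\}$ $$\beta_k=\pi\varepsilon_k+(-1)^{\varepsilon_k}S_k-\Phi_{k-1}(\beta^{k-1})\pmod{2\pi},\qquad S_k:=\arcsin\left(\frac{L_k^2-a_k^2-L_{k-1}^2}{2a_kL_{k-1}}\right).$$ That is, every circular configuration with diagonal vector $L^{n-3}$ arises from such a sequence of choices, and conversely every such sequence of choices produces a circular configuration with diagonal vector $L^{n-3}$.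
   Context: Angles are identified with points of the circle $S^1$ (i.e. taken modulo $2\pi$). For $1\le k\le n-1$ and $\beta^k=(\beta_1,\dots,\beta_k)\in(S^1)^k$ put $$X_k(\beta^k)=\sum_{i=1}^k a_i\cos\beta_i,\qquad Y_k(\beta^k)=\sum_{i=1}^k a_i\sin\beta_i,\qquad L_k(\beta^k)=\sqrt{X_k(\beta^k)^2+Y_k(\beta^k)^2};$$ $L_k(\beta^k)$ is called the $k$-th diagonal length. The set of circular configurations is $$\mathcal{CC}^{\mathrm{onf}}(a^n)=\Bigl\{\beta^{n-1}\in(S^1)^{n-1}: \Bigl\|\sum_{j=1}^{n-1}a_j(\cos\beta_j,\sin\beta_j)\Bigr\|_2^2=a_n^2\Bigr\}.$$ For $(a,b)\in\mathbb{R}^2\setminus\{(0,0)\}$, $\varphi(a,b)$ denotes the angle between the positive $x$-axis and the vector from the origin to the point $(a,b)$, so that $a\sin x+b\cos x=\sqrt{a^2+b^2}\,\sin(x+\varphi(a,b))$ for all $x$. Put $\Phi_k(\beta^k)=\varphi\bigl(Y_k(\beta^k),X_k(\beta^k)\bigr)$ (note the order of the arguments), which is defined when $(X_k(\beta^k),Y_k(\beta^k))\ne(0,0)$. For $1\le k\le n-1$ put $$\mathrm{R}_k^{\min}=\max\Bigl\{0,\ \max_{1\le i\le k}\Bigl(2a_i-\sum_{j=1}^k a_j\Bigr)\Bigr\},\qquad \mathrm{R}_k^{\max}=\sum_{j=1}^k a_j .$$ The diagonal space $\mathcal{DS}(a^n)$ is the set of all $L^{n-3}=(L_2,\dots,L_{n-2})\in\mathbb{R}_{\ge0}^{n-3}$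 such that, with $L_{n-1}:=a_n$, $$L_{n-k-1}\in\bigl[\,|L_{n-k}-a_{n-k}|,\ L_{n-k}+a_{n-k}\bigr]\cap\bigl[\mathrm{R}_{n-k-1}^{\min},\ \mathrm{R}_{n-k-1}^{\max}\bigr]\qquad\text{for all }1\le k\le n-3 .$$ *)

theory Defs
  imports "HOL-Analysis.Analysis"
begin

text \<open>
  The circle of angles modulo $2\pi$ is realised as the unit circle of the complex plane: a real
  number \<open>t\<close> represents the angle \<open>cis t\<close>, so an equation of angles modulo $2\pi$ is an equation
  between values of \<open>cis\<close>, and the cosine and sine of an angle \<open>z\<close> are \<open>Re z\<close> and \<open>Im z\<close>.

  Tuples indexed by \<open>{i..j}\<close> are extensional functions on \<open>{i..j}\<close>, so that equality of tuples is
  equality of functions.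
\<close>

definition S1 :: "complex set" where
  "S1 = sphere 0 1"

lemma S1_eq_range_cis: "S1 = range cis"
proof
  show "S1 \<subseteq> range cis"
  proof
    fix z assume "z \<in> S1"
    then have "z = cis (Arg z)"
      using rcis_cmod_Arg[of z] by (simp add: S1_def rcis_def)
    then show "z \<in> range cis" by blast
  qed
qed (auto simp: S1_def)

definition Xsum :: "(nat \<Rightarrow> real) \<Rightarrow> nat \<Rightarrow> (nat \<Rightarrow> complex) \<Rightarrow> real" where
  "Xsum a k \<beta> = (\<Sum>i=1..k. a i * Re (\<beta> i))"

definition Ysum :: "(nat \<Rightarrow> real) \<Rightarrow> nat \<Rightarrow> (nat \<Rightarrow> complex) \<Rightarrow> real" where
  "Ysum a k \<beta> = (\<Sum>i=1..k. a i * Im (\<beta> i))"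

definition diag_length :: "(nat \<Rightarrow> real) \<Rightarrow> nat \<Rightarrow> (nat \<Rightarrow> complex) \<Rightarrow> real" where
  "diag_length a k \<beta> = sqrt ((Xsum a k \<beta>)\<^sup>2 + (Ysum a k \<beta>)\<^sup>2)"

definition circ_config :: "nat \<Rightarrow> (nat \<Rightarrow> real) \<Rightarrow> (nat \<Rightarrow> complex) set" where
  "circ_config n a =
     {\<beta> \<in> {1..n-1} \<rightarrow>\<^sub>E S1. (norm (\<Sum>j=1..n-1. a j *\<^sub>R (Re (\<beta> j), Im (\<beta> j))))\<^sup>2 = (a n)\<^sup>2}"

definition diag_map :: "nat \<Rightarrow> (nat \<Rightarrow> real) \<Rightarrow> (nat \<Rightarrow> complex) \<Rightarrow> (nat \<Rightarrow> real)" where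
  "diag_map n a \<beta> = (\<lambda>k\<in>{2..n-2}. diag_length a k \<beta>)"

text \<open>The representative of the polar angle in $(-\pi,\pi]$; the value at the origin is irrelevant.\<close>

definition polar_angle :: "real \<Rightarrow> real \<Rightarrow> real" where
  "polar_angle x y = Arg (Complex x y)"

lemma polar_angle_sin:
  "x * sin t + y * cos t = sqrt (x\<^sup>2 + y\<^sup>2) * sin (t + polar_angle x y)"
proof -
  have "rcis (sqrt (x\<^sup>2 + y\<^sup>2)) (polar_angle x y) = Complex x y"
    using rcis_cmod_Arg[of "Complex x y"] by (simp add: polar_angle_def complex_norm)
  then have x: "x = sqrt (x\<^sup>2 + y\<^sup>2) * cos (polar_angle x y)"
    and y: "y = sqrt (x\<^sup>2 + y\<^sup>2) * sin (polar_angle x y)"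
    by (auto simp: rcis_def complex_eq_iff)
  have "x * sin t + y * cos t
        = sqrt (x\<^sup>2 + y\<^sup>2) * cos (polar_angle x y) * sin t
          + sqrt (x\<^sup>2 + y\<^sup>2) * sin (polar_angle x y) * cos t"
    using arg_cong2[OF x y, of "\<lambda>u v. u * sin t + v * cos t"] by (simp only: )
  then show ?thesis
    by (simp only: sin_add algebra_simps)
qed

definition Phi :: "(nat \<Rightarrow> real) \<Rightarrow> nat \<Rightarrow> (nat \<Rightarrow> complex) \<Rightarrow> real" where
  "Phi a k \<beta> = polar_angle (Ysum a k \<beta>) (Xsum a k \<beta>)"

definition Rmin :: "(nat \<Rightarrow> real) \<Rightarrow> nat \<Rightarrow> real" where
  "Rmin a k = max 0 (Max ((\<lambda>i. 2 * a i - (\<Sum>j=1..k. a j)) ` {1..k}))"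

definition Rmax :: "(nat \<Rightarrow> real) \<Rightarrow> nat \<Rightarrow> real" where
  "Rmax a k = (\<Sum>j=1..k. a j)"

definition diagonal_space :: "nat \<Rightarrow> (nat \<Rightarrow> real) \<Rightarrow> (nat \<Rightarrow> real) set" where
  "diagonal_space n a =
     {L \<in> {2..n-2} \<rightarrow>\<^sub>E {0..}.
        let M = L(n-1 := a n) in
        \<forall>k\<in>{1..n-3}.
          M (n-k-1) \<in> {\<bar>M (n-k) - a (n-k)\<bar> .. M (n-k) + a (n-k)}
                       \<inter> {Rmin a (n-k-1) .. Rmax a (n-k-1)}}"

text \<open>
  In the next two definitions \<open>L\<close> is the extended family $(L_0,\dots,L_{n-1})$.  The value
  \<open>Phi a (k-1) \<beta>\<close> only involves $\beta_1,\dots,\beta_{k-1}$, so the condition on \<open>k\<close> prescribes the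
  choice of $\beta_k$ in terms of the preceding angles.
\<close>

definition S_angle :: "(nat \<Rightarrow> real) \<Rightarrow> (nat \<Rightarrow> real) \<Rightarrow> nat \<Rightarrow> real" where
  "S_angle a L k = arcsin (((L k)\<^sup>2 - (a k)\<^sup>2 - (L (k-1))\<^sup>2) / (2 * a k * L (k-1)))"

definition choice_sequences ::
    "nat \<Rightarrow> (nat \<Rightarrow> real) \<Rightarrow> (nat \<Rightarrow> real) \<Rightarrow> (nat \<Rightarrow> complex) set" where
  "choice_sequences n a L =
     {\<beta> \<in> {1..n-1} \<rightarrow>\<^sub>E S1. \<forall>k\<in>{1..n-1}.
        L (k-1) = 0 \<or>
        L (k-1) > 0 \<and>
          (\<exists>\<epsilon>\<in>{0, 1::nat}.
             \<beta> k = cis (pi * real \<epsilon> + (-1) ^ \<epsilon> * S_angle a L k - Phi a (k-1) \<beta>))}"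

end

theory Submission
  imports Defs
begin

text \<open>
  Adding the link \<open>a k\<close> in direction \<open>\<beta> k\<close> to the chain of the first \<open>k - 1\<close> links changes the
  squared diagonal length by
  \<open>(a k)\<^sup>2 + 2 * a k * (Xsum a (k-1) \<beta> * Re (\<beta> k) + Ysum a (k-1) \<beta> * Im (\<beta> k))\<close>.
  In terms of the angle \<open>t\<close> of \<open>\<beta> k\<close>, the bracket is the previous diagonal length times
  \<open>sin (t + Phi a (k-1) \<beta>)\<close>.  Hence, once the \<open>(k-1)\<close>-st diagonal length is right and nonzero,
  prescribing the \<open>k\<close>-th one means prescribing a sine, which leaves the two angles of choice (b)
  (\<open>diag_length_eq_iff_choice\<close>).  If the previous diagonal length is zero, the next one is
  \<open>a k\<close> whatever the direction.

  The conditions defining the diagonal space say that \<open>L k\<close>, \<open>a k\<close> and \<open>L (k-1)\<close> are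
  the sides of a possibly degenerate triangle for \<open>2 \<le> k \<le> n - 1\<close> (\<open>diagonal_space_triangle\<close>).
  This puts the argument of the arcsine into \<open>[-1, 1]\<close>, and it forces \<open>L k = a k\<close> when
  \<open>L (k-1) = 0\<close>.  Induction along the chain then shows that a sequence of choices is the same as
  a tuple of angles all of whose diagonal lengths are the prescribed ones, and these tuples are
  exactly the elements of the preimage.
\<close>

text \<open>
  The sine determines an angle up to the reflection at the vertical axis.
\<close>

lemma sin_eq_iff_cis_arcsin:
  assumes "-1 \<le> s" "s \<le> 1"
  shows "sin u = s \<longleftrightarrow>
           (\<exists>\<epsilon>\<in>{0, 1::nat}. cis u = cis (pi * real \<epsilon> + (-1) ^ \<epsilon> * arcsin s))"
proof -
  have "(cos u)\<^sup>2 = (cos (arcsin s))\<^sup>2" if "sin u = s"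
    using that assms by (simp add: cos_squared_eq)
  then have "sin u = s \<Longrightarrow> cos u = cos (arcsin s) \<or> cos u = - cos (arcsin s)"
    by (simp add: power2_eq_iff)
  then show ?thesis
    using assms by (auto simp: complex_eq_iff)
qed

lemma Xsum_step: "k \<ge> 1 \<Longrightarrow> Xsum a k \<beta> = Xsum a (k-1) \<beta> + a k * Re (\<beta> k)"
  by (cases k) (auto simp: Xsum_def)

lemma Ysum_step: "k \<ge> 1 \<Longrightarrow> Ysum a k \<beta> = Ysum a (k-1) \<beta> + a k * Im (\<beta> k)"
  by (cases k) (auto simp: Ysum_def)

lemma diag_length_nonneg: "diag_length a k \<beta> \<ge> 0"
  by (simp add: diag_length_def)

lemma diag_length_sq: "(diag_length a k \<beta>)\<^sup>2 = (Xsum a k \<beta>)\<^sup>2 + (Ysum a k \<beta>)\<^sup>2"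
  by (simp add: diag_length_def)

lemma diag_length_0 [simp]: "diag_length a 0 \<beta> = 0"
  by (simp add: diag_length_def Xsum_def Ysum_def)

text \<open>The law of cosines, with the angle at the joint measured by a sine.\<close>

lemma diag_length_step:
  assumes "k \<ge> 1" and t: "\<beta> k = cis t"
  shows "(diag_length a k \<beta>)\<^sup>2 = (diag_length a (k-1) \<beta>)\<^sup>2 + (a k)\<^sup>2
           + 2 * a k * (diag_length a (k-1) \<beta> * sin (t + Phi a (k-1) \<beta>))"
proof -
  define X Y where "X = Xsum a (k-1) \<beta>" and "Y = Ysum a (k-1) \<beta>"
  have "(diag_length a k \<beta>)\<^sup>2 = (X + a k * cos t)\<^sup>2 + (Y + a k * sin t)\<^sup>2"
    using assms by (simp add: diag_length_sq Xsum_step Ysum_step X_def Y_def)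
  also have "\<dots> = X\<^sup>2 + Y\<^sup>2 + (a k)\<^sup>2 * ((sin t)\<^sup>2 + (cos t)\<^sup>2)
                   + 2 * a k * (Y * sin t + X * cos t)"
    by algebra
  also have "Y * sin t + X * cos t = diag_length a (k-1) \<beta> * sin (t + Phi a (k-1) \<beta>)"
    using polar_angle_sin[of Y t X] by (simp add: X_def Y_def diag_length_def Phi_def add.commute)
  finally show ?thesis
    using diag_length_sq[of a "k-1" \<beta>] by (simp add: X_def Y_def)
qed

lemma diag_length_after_0:
  assumes "k \<ge> 1" "a k > 0" "\<beta> k \<in> S1" "diag_length a (k-1) \<beta> = 0"
  shows "diag_length a k \<beta> = a k"
proof -
  obtain t where "\<beta> k = cis t"
    using assms(3) by (auto simp: S1_eq_range_cis)
  then have "(diag_length a k \<beta>)\<^sup>2 = (a k)\<^sup>2"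
    using diag_length_step[of k \<beta> t a] assms by simp
  then show ?thesis
    using assms(2) diag_length_nonneg[of a k \<beta>] by (simp add: power2_eq_iff_nonneg)
qed

text \<open>
  The triangle inequalities are what makes \<open>arcsin\<close> in \<open>S_angle\<close> a genuine inverse sine.
\<close>

lemma diag_length_eq_iff_choice:
  assumes "k \<ge> 1" "a k > 0" "\<beta> k \<in> S1"
    and prev: "diag_length a (k-1) \<beta> = L (k-1)" "L (k-1) > 0"
    and tri: "\<bar>L k - a k\<bar> \<le> L (k-1)" "L (k-1) \<le> L k + a k"
  shows "diag_length a k \<beta> = L k \<longleftrightarrow>
           (\<exists>\<epsilon>\<in>{0, 1::nat}.
              \<beta> k = cis (pi * real \<epsilon> + (-1) ^ \<epsilon> * S_angle a L k - Phi a (k-1) \<beta>))"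
proof -
  define r where "r = L (k-1)"
  define s where "s = ((L k)\<^sup>2 - (a k)\<^sup>2 - r\<^sup>2) / (2 * a k * r)"
  obtain t where t: "\<beta> k = cis t"
    using assms(3) by (auto simp: S1_eq_range_cis)
  have pos: "2 * a k * r > 0" and Lk: "L k \<ge> 0"
    using assms by (auto simp: r_def)
  have "(L k)\<^sup>2 \<le> (r + a k)\<^sup>2"
    using tri Lk by (intro power_mono) (auto simp: r_def)
  moreover have "\<bar>r - a k\<bar>\<^sup>2 \<le> (L k)\<^sup>2"
    using tri by (intro power_mono) (auto simp: r_def)
  ultimately have s: "-1 \<le> s" "s \<le> 1"
    using pos by (simp_all add: s_def field_simps power2_eq_square)
  have "diag_length a k \<beta> = L k \<longleftrightarrow> (diag_length a k \<beta>)\<^sup>2 = (L k)\<^sup>2"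
    using Lk diag_length_nonneg[of a k \<beta>] by (simp add: power2_eq_iff_nonneg)
  also have "\<dots> \<longleftrightarrow> (2 * a k * r) * sin (t + Phi a (k-1) \<beta>) = (L k)\<^sup>2 - (a k)\<^sup>2 - r\<^sup>2"
    using diag_length_step[where \<beta> = \<beta> and k = k and a = a, OF assms(1) t] prev by (auto simp: r_def algebra_simps)
  also have "\<dots> \<longleftrightarrow> sin (t + Phi a (k-1) \<beta>) = s"
    using pos unfolding s_def by (subst eq_divide_eq) (auto simp: mult.commute)
  also have "\<dots> \<longleftrightarrow> (\<exists>\<epsilon>\<in>{0, 1::nat}.
      cis (t + Phi a (k-1) \<beta>) = cis (pi * real \<epsilon> + (-1) ^ \<epsilon> * S_angle a L k))"
    using sin_eq_iff_cis_arcsin[OF s] by (simp add: S_angle_def s_def r_def)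
  also have "\<dots> \<longleftrightarrow> (\<exists>\<epsilon>\<in>{0, 1::nat}.
      \<beta> k = cis (pi * real \<epsilon> + (-1) ^ \<epsilon> * S_angle a L k - Phi a (k-1) \<beta>))"
    by (simp add: t cis_mult[symmetric] cis_divide[symmetric] field_simps)
  finally show ?thesis .
qed

text \<open>
  For \<open>k \<ge> 3\<close> the triangle inequalities are the first interval in the definition of the diagonal
  space.  For \<open>k = 2\<close> they come from the second one, because
  \<open>Rmin a 2 = \<bar>a 1 - a 2\<bar>\<close> and \<open>Rmax a 2 = a 1 + a 2\<close>.
\<close>

lemma diagonal_space_triangle:
  assumes "n \<ge> 4" "L \<in> diagonal_space n a" "k \<in> {2..n-1}"
  defines "M \<equiv> L(0 := 0, 1 := a 1, n-1 := a n)"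
  shows "\<bar>M k - a k\<bar> \<le> M (k-1)" "M (k-1) \<le> M k + a k"
proof -
  have D: "(L(n-1 := a n)) (n-j-1) \<in>
             {\<bar>(L(n-1 := a n)) (n-j) - a (n-j)\<bar> .. (L(n-1 := a n)) (n-j) + a (n-j)}
             \<inter> {Rmin a (n-j-1) .. Rmax a (n-j-1)}" if "j \<in> {1..n-3}" for j
    using assms(2) that unfolding diagonal_space_def Let_def by blast
  have "\<bar>M k - a k\<bar> \<le> M (k-1) \<and> M (k-1) \<le> M k + a k"
  proof (cases "k = 2")
    case True
    have idx: "n - (n-3) - 1 = 2" "n-3 \<in> {1..n-3}"
      using assms(1) by auto
    have M: "M 2 = L 2" "M 1 = a 1" "(L(n-1 := a n)) 2 = L 2"
      using assms(1) by (auto simp: M_def)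
    with D[of "n-3"] idx have "M 2 \<in> {Rmin a 2 .. Rmax a 2}"
      by (metis Int_iff)
    moreover have "{1..2::nat} = {1, 2}"
      by auto
    ultimately have "\<bar>a 1 - a 2\<bar> \<le> M 2" "M 2 \<le> a 1 + a 2"
      by (auto simp: Rmin_def Rmax_def)
    then show ?thesis
      using True M by auto
  next
    case False
    then have k: "n - (n-k) = k" "n-k \<in> {1..n-3}"
      using assms by auto
    have "M k = (L(n-1 := a n)) k" "M (k-1) = (L(n-1 := a n)) (k-1)"
      using False assms(1,3) by (auto simp: M_def)
    then show ?thesis
      using D[OF k(2)] unfolding k(1) by (simp only: Int_iff atLeastAtMost_iff)
  qed
  then show "\<bar>M k - a k\<bar> \<le> M (k-1)" "M (k-1) \<le> M k + a k"
    by auto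
qed

text \<open>
  Closing up is the condition at \<open>k = n - 1\<close>, and the condition at \<open>k = 1\<close> holds for all angles.
\<close>

lemma preimage_iff_diag_lengths:
  assumes "n \<ge> 4" and pos: "\<And>i. i \<in> {1..n} \<Longrightarrow> a i > 0" and L: "L \<in> diagonal_space n a"
    and \<beta>: "\<beta> \<in> {1..n-1} \<rightarrow>\<^sub>E S1"
  defines "M \<equiv> L(0 := 0, 1 := a 1, n-1 := a n)"
  shows "\<beta> \<in> circ_config n a \<and> diag_map n a \<beta> = L \<longleftrightarrow> (\<forall>k\<in>{1..n-1}. diag_length a k \<beta> = M k)"
proof -
  have "(\<Sum>j=1..n-1. a j *\<^sub>R (Re (\<beta> j), Im (\<beta> j))) = (Xsum a (n-1) \<beta>, Ysum a (n-1) \<beta>)"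
    by (simp add: prod_eq_iff fst_sum snd_sum Xsum_def Ysum_def)
  then have closed: "\<beta> \<in> circ_config n a \<longleftrightarrow> diag_length a (n-1) \<beta> = a n"
    using \<beta> pos[of n] diag_length_nonneg[of a "n-1" \<beta>] assms(1)
    by (simp add: circ_config_def norm_Pair diag_length_def power2_eq_iff_nonneg
        del: power_mult_distrib real_sqrt_pow2)
  have ext: "L \<in> extensional {2..n-2}"
    using L by (auto simp: diagonal_space_def PiE_def)
  have diag: "diag_map n a \<beta> = L \<longleftrightarrow> (\<forall>k\<in>{2..n-2}. diag_length a k \<beta> = L k)"
    using ext by (auto simp: diag_map_def fun_eq_iff restrict_def extensional_def)
  have first: "diag_length a 1 \<beta> = a 1"
    using assms(1) \<beta> pos[of 1] by (intro diag_length_after_0) auto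
  have "{1..n-1} = insert 1 (insert (n-1) {2..n-2})"
    using assms(1) by auto
  moreover have "M 1 = a 1" "M (n-1) = a n" "\<forall>k\<in>{2..n-2}. M k = L k"
    using assms(1) by (auto simp: M_def)
  ultimately show ?thesis
    using closed diag first by auto
qed

theorem mainTheorem2:
  fixes n :: nat and a L :: "nat \<Rightarrow> real"
  assumes "n \<ge> 4"
    and "\<And>i. i \<in> {1..n} \<Longrightarrow> a i > 0"
    and "L \<in> diagonal_space n a"
  shows "{\<beta> \<in> circ_config n a. diag_map n a \<beta> = L}
         = choice_sequences n a (L(0 := 0, 1 := a 1, n-1 := a n))"
proof -
  define M where "M = L(0 := 0, 1 := a 1, n-1 := a n)"
  have M01: "M 0 = 0" "M 1 = a 1"
    using assms(1) by (auto simp: M_def)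
  note tri = diagonal_space_triangle[OF assms(1,3), folded M_def]
  define choice where "choice = (\<lambda>\<beta> k. M (k-1) = 0 \<or> M (k-1) > 0 \<and>
      (\<exists>\<epsilon>\<in>{0, 1::nat}. \<beta> k = cis (pi * real \<epsilon> + (-1) ^ \<epsilon> * S_angle a M k - Phi a (k-1) \<beta>)))"
  have step: "diag_length a k \<beta> = M k \<longleftrightarrow> choice \<beta> k"
    if \<beta>: "\<beta> \<in> {1..n-1} \<rightarrow>\<^sub>E S1" and k: "k \<in> {1..n-1}"
      and prev: "diag_length a (k-1) \<beta> = M (k-1)" for \<beta> k
  proof -
    have k': "k \<ge> 1" "a k > 0" "\<beta> k \<in> S1"
      using \<beta> k assms(2)[of k] by auto
    show ?thesis
    proof (cases "M (k-1) = 0")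
      case True
      then have "M k = a k"
        using tri[of k] M01 k by (cases "k = 1") auto
      then show ?thesis
        using True prev diag_length_after_0[of k a \<beta>] k' by (simp add: choice_def)
    next
      case False
      then have "M (k-1) > 0"
        using prev diag_length_nonneg[of a "k-1" \<beta>] by simp
      moreover have "k \<in> {2..n-1}"
        using False M01 k by (cases "k = 1") auto
      ultimately show ?thesis
        using diag_length_eq_iff_choice[where a = a and L = M, OF k' prev] tri[of k]
        by (simp add: choice_def)
    qed
  qed
  have lengths_iff: "(\<forall>k\<in>{1..n-1}. diag_length a k \<beta> = M k) \<longleftrightarrow> (\<forall>k\<in>{1..n-1}. choice \<beta> k)"
    if \<beta>: "\<beta> \<in> {1..n-1} \<rightarrow>\<^sub>E S1" for \<beta>
  proof
    assume lengths: "\<forall>k\<in>{1..n-1}. diag_length a k \<beta> = M k"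
    show "\<forall>k\<in>{1..n-1}. choice \<beta> k"
    proof
      fix k assume k: "k \<in> {1..n-1}"
      have "diag_length a (k-1) \<beta> = M (k-1)"
      proof (cases "k = 1")
        case False
        then have "k - 1 \<in> {1..n-1}"
          using k by auto
        then show ?thesis
          using lengths by blast
      qed (simp add: M01)
      then show "choice \<beta> k"
        using step[OF \<beta> k] lengths k by blast
    qed
  next
    assume choices: "\<forall>k\<in>{1..n-1}. choice \<beta> k"
    have "diag_length a k \<beta> = M k" if "k \<le> n-1" for k
      using that
    proof (induction k)
      case 0
      then show ?case by (simp add: M01)
    next
      case (Suc k)
      then show ?case
        using step[OF \<beta>, of "Suc k"] choices by simp
    qed
    then show "\<forall>k\<in>{1..n-1}. diag_length a k \<beta> = M k"
      by auto
  qed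
  have choices_eq: "choice_sequences n a M
      = {\<beta> \<in> {1..n-1} \<rightarrow>\<^sub>E S1. \<forall>k\<in>{1..n-1}. choice \<beta> k}"
    by (simp only: choice_sequences_def choice_def)
  have "\<beta> \<in> {1..n-1} \<rightarrow>\<^sub>E S1" if "\<beta> \<in> circ_config n a" for \<beta>
    using that by (simp add: circ_config_def)
  then have "{\<beta> \<in> circ_config n a. diag_map n a \<beta> = L} = choice_sequences n a M"
    using preimage_iff_diag_lengths[OF assms, folded M_def] lengths_iff
    unfolding choices_eq by blast
  then show ?thesis
    by (simp only: M_def)
qed

end
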